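(* Let $T>0$, $I=[-T,T]$, $m\in\mathbb{R}\setminus\{0\}$, $\lambda\in\mathbb{R}$, and let $R_m:\mathcal{F}_\lambda(I)\to L^1(I)$ be the operator defined by $(R_m x)(t)=x'(t)+m\,x(-t)$. Then: 1. $R_m$ is strongly inverse positive on $\mathcal{F}_\lambda(I)$ if and only if $m\in(0,\frac{\pi}{4T}]$ and $\lambda\ge 0$. 2. $R_m$ is strongly inverse negative on $\mathcal{F}_\lambda(I)$ if and only if $m\in[-\frac{\pi}{4T},0)$ and $\lambda\ge 0$.
   Context: $\mathcal{F}_\lambda(I)$ is the set of real differentiable functions $f$ on $I$ such that $f(-T)-f(T)=\lambda$. For a function $y$ on $I$, $y\succ 0$ means $y>0$ almost everywhere on $I$. An operator $R:\mathcal{F}_\lambda(I)\to L^1(I)$ is strongly inverse positive on $\mathcal{F}_\lambda(I)$ if for all $x\in\mathcal{F}_\lambda(I)$, $Rx\succ0$ implies $x>0$ (on $I$); it is strongly inverse negative on $\mathcal{F}_\lambda(I)$ if for all $x\in\mathcal{F}_\lambda(I)$, $Rx\succ 0$ implies $x<0$ (on $I$). *)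

theory Defs
  imports "HOL-Analysis.Analysis"
begin

text \<open>
  Functions on \<open>I = [-T, T]\<close> are total functions whose values outside \<open>I\<close> are never
  inspected; differentiability and derivatives are taken within \<open>I\<close>, hence one-sided at
  \<open>-T\<close> and \<open>T\<close>.
\<close>

definition F_space :: "real \<Rightarrow> real \<Rightarrow> (real \<Rightarrow> real) set" where
  "F_space lam T = {f. f differentiable_on {-T..T} \<and> f (-T) - f T = lam}"

definition ae_positive :: "real set \<Rightarrow> (real \<Rightarrow> real) \<Rightarrow> bool" where
  "ae_positive I y \<longleftrightarrow> (AE t in lebesgue_on I. 0 < y t)"

definition strongly_inverse_positive ::
  "real set \<Rightarrow> (real \<Rightarrow> real) set \<Rightarrow> ((real \<Rightarrow> real) \<Rightarrow> (real \<Rightarrow> real)) \<Rightarrow> bool" where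
  "strongly_inverse_positive I F R \<longleftrightarrow>
     (\<forall>x\<in>F. ae_positive I (R x) \<longrightarrow> (\<forall>t\<in>I. 0 < x t))"

definition strongly_inverse_negative ::
  "real set \<Rightarrow> (real \<Rightarrow> real) set \<Rightarrow> ((real \<Rightarrow> real) \<Rightarrow> (real \<Rightarrow> real)) \<Rightarrow> bool" where
  "strongly_inverse_negative I F R \<longleftrightarrow>
     (\<forall>x\<in>F. ae_positive I (R x) \<longrightarrow> (\<forall>t\<in>I. x t < 0))"

definition reflection_op :: "real \<Rightarrow> real \<Rightarrow> (real \<Rightarrow> real) \<Rightarrow> (real \<Rightarrow> real)" where
  "reflection_op T m x = (\<lambda>t. vector_derivative x (at t within {-T..T}) + m * x (-t))"

text \<open>
  The operator is meant to take values in \<open>L\<^sup>1(I)\<close>, although the derivative of an everywhere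
  differentiable function need not be Lebesgue integrable. The definitions above impose no
  integrability, and none is needed: only functions with an almost everywhere positive image
  matter, and for those the image is in \<open>L\<^sup>1(I)\<close> automatically.
\<close>

lemma reflection_op_integrable:
  assumes "T > 0" and x: "x \<in> F_space lam T"
    and pos: "ae_positive {-T..T} (reflection_op T m x)"
  shows "integrable (lebesgue_on {-T..T}) (reflection_op T m x)"
proof -
  let ?I = "{-T..T}" and ?h = "reflection_op T m x"
  have diff: "x differentiable_on ?I"
    using x by (simp add: F_space_def)
  have "((\<lambda>t. vector_derivative x (at t within ?I)) has_integral (x T - x (-T))) ?I"
    using diff \<open>T > 0\<close>
    by (intro fundamental_theorem_of_calculus)
       (auto simp: differentiable_on_def vector_derivative_works[symmetric])
  moreover have "continuous_on ?I (\<lambda>t. m * x (-t))"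
    by (intro continuous_intros continuous_on_compose2[OF differentiable_imp_continuous_on[OF diff]]) auto
  then have "(\<lambda>t. m * x (-t)) integrable_on ?I"
    by (rule integrable_continuous_interval)
  ultimately have h: "?h integrable_on ?I"
    unfolding reflection_op_def
    by (rule Henstock_Kurzweil_Integration.integrable_add[OF has_integral_integrable])
  have "AE t in lebesgue. t \<in> ?I \<longrightarrow> 0 < ?h t"
    using pos by (simp add: ae_positive_def AE_restrict_space_iff)
  then obtain N where N: "N \<in> null_sets lebesgue" "\<And>t. \<lbrakk>t \<in> ?I; t \<notin> N\<rbrakk> \<Longrightarrow> 0 < ?h t"
    by (elim AE_E3) simp
  then have neg: "negligible N"
    by (simp add: negligible_iff_null_sets)
  have eq: "max 0 (?h t) = ?h t" if "t \<in> ?I - N" for t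
    using N(2)[of t] that by simp
  have "(\<lambda>t. max 0 (?h t)) integrable_on ?I"
    by (rule integrable_spike[OF h neg eq])
  then have "(\<lambda>t. max 0 (?h t)) absolutely_integrable_on ?I"
    by (intro nonnegative_absolutely_integrable_1) auto
  then have "?h absolutely_integrable_on ?I"
    by (rule absolutely_integrable_spike[OF _ neg]) (simp add: eq)
  then show ?thesis
    by (simp add: set_integrable_def integrable_restrict_space)
qed

end

theory Submission
  imports Defs
begin

text \<open>
  Only the positive case needs work: the point reflection sending \<open>x\<close> to \<open>t \<mapsto> - x (-t)\<close> keeps
  \<open>x (-T) - x T\<close> and turns the equation with coefficient \<open>m\<close> into the one with coefficient
  \<open>-m\<close>, so inverse negativity for \<open>m\<close> is inverse positivity for \<open>-m\<close>
  (\<open>strongly_inverse_negative_iff_positive_uminus\<close>).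

  Sufficiency. Let \<open>x' t + m * x (-t) = h t\<close>. On \<open>[0, T]\<close> the point
  \<open>(x (-t), x t)\<close> of the plane solves a first-order system which for \<open>h = 0\<close> is the rotation
  with angular velocity \<open>-m\<close>. In coordinates rotating along,
  \<open>W t = x (-t) * cos (m * t + \<phi>) - x t * sin (m * t + \<phi>)\<close> has derivative
  \<open>- h (-t) * cos (m * t + \<phi>) - h t * sin (m * t + \<phi>)\<close>, so \<open>W\<close> decreases strictly as long as
  \<open>m * t + \<phi>\<close> stays in the first quadrant (\<open>rotated_coordinate_less\<close>). There are two useful
  phases. With \<open>\<phi> = pi/4\<close> the two components cancel at \<open>t = 0\<close>, whence \<open>W < 0\<close> afterwards;
  staying in the first quadrant is exactly \<open>m * T \<le> pi/4\<close>. With \<open>\<phi> = pi/4 - m * T\<close> the final value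
  is a positive multiple of \<open>x (-T) - x T = lam \<ge> 0\<close>, whence \<open>W > 0\<close> before. The two signs confine
  \<open>(x (-t), x t)\<close> between two lines through the origin, on the side where both components are
  positive.

  Necessity. A function \<open>y\<close> with \<open>y (-T) = y T\<close> whose image under the operator is bounded below by
  a positive constant, and which is nonpositive somewhere, refutes inverse positivity for every
  \<open>lam\<close> at once: add a large multiple of it to an affine function in the right class
  (\<open>not_strongly_inverse_positiveI\<close>). Such a \<open>y\<close> exists for \<open>m < 0\<close> (a constant), for
  \<open>m * T > pi/2\<close> (a constant plus one period of a cosine) and for \<open>pi/4 < m * T \<le> pi/2\<close> (a solution of the
  homogeneous equation, with its boundary values corrected by a high odd power of \<open>t\<close>). For the
  remaining \<open>m\<close> and \<open>lam < 0\<close>, a negative multiple of the homogeneous solution, shifted up by a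
  constant, is a counterexample.
\<close>

section \<open>The operator and almost everywhere positivity\<close>
lemma ae_positive_iff_negligible:
  fixes a b :: real
  shows "ae_positive {a..b} y \<longleftrightarrow> (\<exists>N. negligible N \<and> (\<forall>t\<in>{a..b} - N. 0 < y t))"
proof
  assume "ae_positive {a..b} y"
  then have "AE t in lebesgue. t \<in> {a..b} \<longrightarrow> 0 < y t"
    by (simp add: ae_positive_def AE_restrict_space_iff)
  then obtain N where "N \<in> null_sets lebesgue" "\<And>t. \<lbrakk>t \<in> {a..b}; t \<notin> N\<rbrakk> \<Longrightarrow> 0 < y t"
    by (elim AE_E3) simp
  then show "\<exists>N. negligible N \<and> (\<forall>t\<in>{a..b} - N. 0 < y t)"
    by (metis DiffE negligible_iff_null_sets)
next
  assume "\<exists>N. negligible N \<and> (\<forall>t\<in>{a..b} - N. 0 < y t)"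
  then obtain N where N: "N \<in> null_sets lebesgue" "\<And>t. t \<in> {a..b} - N \<Longrightarrow> 0 < y t"
    by (auto simp: negligible_iff_null_sets)
  have "AE t in lebesgue. t \<in> {a..b} \<longrightarrow> 0 < y t"
    by (rule AE_I'[OF N(1)]) (use N(2) in auto)
  then show "ae_positive {a..b} y"
    by (simp add: ae_positive_def AE_restrict_space_iff)
qed

lemma reflection_op_eq:
  assumes "(x has_real_derivative D) (at t within {-T..T})" "t \<in> {-T..T}" "T > 0"
  shows "reflection_op T m x t = D + m * x (-t)"
  using assms
  by (simp add: reflection_op_def has_real_derivative_iff_has_vector_derivative
      vector_derivative_within_closed_interval)

lemma F_space_has_derivative:
  assumes "x \<in> F_space lam T" "t \<in> {-T..T}"
  obtains D where "(x has_real_derivative D) (at t within {-T..T})"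
  using assms unfolding F_space_def differentiable_on_def real_differentiable_def by blast

lemma has_real_derivative_compose_uminus:
  assumes "(x has_real_derivative D) (at (-t) within uminus ` S)"
  shows "((\<lambda>t. x (-t)) has_real_derivative - D) (at t within S)"
proof -
  have "(uminus has_real_derivative -1) (at t within S)"
    by (auto intro!: derivative_eq_intros)
  from DERIV_image_chain[OF assms this] show ?thesis
    by (simp add: o_def)
qed

lemma negligible_uminus:
  fixes N :: "real set"
  assumes "negligible N"
  shows "negligible (uminus ` N)"
  using assms by (intro negligible_differentiable_image_negligible) auto

text \<open>
  The derivative may fail to be continuous, so monotonicity comes from the fundamental theorem for
  the gauge integral, which ignores negligible sets. Strictness needs no integral: if the
  end values agreed, \<open>f\<close> would be constant and its derivative zero throughout the interval, which is not
  negligible.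
\<close>
lemma ae_positive_derivative_imp_less:
  fixes f f' :: "real \<Rightarrow> real"
  assumes "a < b"
    and deriv: "\<And>t. t \<in> {a..b} \<Longrightarrow> (f has_real_derivative f' t) (at t within {a..b})"
    and N: "negligible N" and pos: "\<And>t. t \<in> {a<..<b} - N \<Longrightarrow> 0 < f' t"
  shows "f a < f b"
proof -
  have le: "f c \<le> f d" if "a \<le> c" "c \<le> d" "d \<le> b" for c d
  proof -
    have "(f' has_integral (f d - f c)) {c..d}"
      using that
      by (intro fundamental_theorem_of_calculus)
         (auto simp: has_real_derivative_iff_has_vector_derivative[symmetric]
               intro: has_field_derivative_subset[OF deriv])
    then have "((\<lambda>t. if t \<in> N \<union> {a, b} then 0 else f' t) has_integral (f d - f c)) {c..d}"
      by (rule has_integral_spike[where S = "N \<union> {a, b}", rotated 2]) (use N in auto)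
    then have "0 \<le> f d - f c"
      by (rule has_integral_nonneg) (use that pos in \<open>force simp: less_imp_le\<close>)
    then show ?thesis by simp
  qed
  show ?thesis
  proof (rule ccontr)
    assume "\<not> f a < f b"
    then have const: "f t = f a" if "t \<in> {a..b}" for t
      using le[of a t] le[of t b] that by force
    have "\<not> negligible {a<..<b}"
      using \<open>a < b\<close> open_not_negligible[of "{a<..<b}"] by auto
    then obtain t where t: "t \<in> {a<..<b} - N"
      using negligible_subset[OF N] by blast
    then have "(f has_real_derivative f' t) (at t)"
      using deriv[of t] at_within_Icc_at[of a t b] by simp
    moreover have "(f has_real_derivative 0) (at t)"
    proof (rule has_field_derivative_transform_within_open)
      show "((\<lambda>_. f a) has_real_derivative 0) (at t)" by simp
      show "open {a<..<b}" "t \<in> {a<..<b}" using t by auto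
      show "f a = f s" if "s \<in> {a<..<b}" for s
        using const[of s] that by simp
    qed
    ultimately have "f' t = 0"
      by (rule DERIV_unique)
    then show False
      using pos[OF t] by simp
  qed
qed

section \<open>Sufficiency\<close>

text \<open>
  The rotating coordinate removes the terms \<open>m * x t\<close> and \<open>m * x (-t)\<close> from the derivative. What
  is left is \<open>- h (-t) * cos (m * t + \<phi>) - h t * sin (m * t + \<phi>)\<close> with \<open>h\<close> the image of \<open>x\<close>,
  and the bounds on \<open>\<phi>\<close> place the angle in the first quadrant.
\<close>
lemma rotated_coordinate_less:
  fixes \<phi> :: real
  assumes "T > 0" and x: "x \<in> F_space lam T"
    and pos: "ae_positive {-T..T} (reflection_op T m x)"
    and "0 < m" "0 \<le> \<phi>" "m * T + \<phi> \<le> pi / 2" and "0 \<le> a" "a < b" "b \<le> T"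
  shows "x (-b) * cos (m * b + \<phi>) - x b * sin (m * b + \<phi>)
       < x (-a) * cos (m * a + \<phi>) - x a * sin (m * a + \<phi>)"
proof -
  define h where "h = reflection_op T m x"
  obtain N where N: "negligible N" "\<And>t. t \<in> {-T..T} - N \<Longrightarrow> 0 < h t"
    using pos by (auto simp: ae_positive_iff_negligible h_def)
  have dx: "(x has_real_derivative h t - m * x (-t)) (at t within {-T..T})" if t: "t \<in> {-T..T}" for t
  proof -
    obtain D where D: "(x has_real_derivative D) (at t within {-T..T})"
      using F_space_has_derivative[OF x t] .
    then show ?thesis
      using reflection_op_eq[OF D t \<open>T > 0\<close>, of m] by (simp add: h_def)
  qed
  \<comment> \<open>The negated coordinate, so that its derivative is positive.\<close>
  define W where "W = (\<lambda>t. x t * sin (m * t + \<phi>) - x (-t) * cos (m * t + \<phi>))"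
  have dW: "(W has_real_derivative h t * sin (m * t + \<phi>) + h (-t) * cos (m * t + \<phi>))
      (at t within {a..b})" if "t \<in> {a..b}" for t
  proof -
    have d1: "(x has_real_derivative h t - m * x (-t)) (at t within {a..b})"
      by (rule has_field_derivative_subset[OF dx]) (use that assms in auto)
    have "(x has_real_derivative h (-t) - m * x t) (at (-t) within uminus ` {a..b})"
      using has_field_derivative_subset[OF dx[of "-t"], of "uminus ` {a..b}"] that assms by auto
    then have d2: "((\<lambda>t. x (-t)) has_real_derivative - (h (-t) - m * x t)) (at t within {a..b})"
      by (rule has_real_derivative_compose_uminus)
    show ?thesis
      unfolding W_def
      by (rule derivative_eq_intros d1 d2 refl)+ (simp add: algebra_simps)
  qed
  have "W a < W b"
  proof (rule ae_positive_derivative_imp_less[OF \<open>a < b\<close> dW])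
    show "negligible (N \<union> uminus ` N)"
      by (rule negligible_Un[OF N(1) negligible_uminus[OF N(1)]])
    fix t assume t: "t \<in> {a<..<b} - (N \<union> uminus ` N)"
    \<comment> \<open>Both \<open>h t\<close> and \<open>h (-t)\<close> enter the derivative, so \<open>N\<close> and its mirror image are excluded.\<close>
    then have "-t \<notin> N" by force
    then have h: "0 < h t" "0 < h (-t)"
      using N(2) t assms by auto
    have "m * t < m * T" "0 < m * t"
      using t assms by auto
    then have "0 < m * t + \<phi>" "m * t + \<phi> < pi / 2"
      using assms by linarith+
    then show "0 < h t * sin (m * t + \<phi>) + h (-t) * cos (m * t + \<phi>)"
      using h sin_gt_zero2 cos_gt_zero by (simp add: add_pos_pos)
  qed auto
  then show ?thesis by (simp add: W_def)
qed

text \<open>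
  Two lines through the origin bound the ratio of \<open>p\<close> and \<open>q\<close> from both sides; eliminating \<open>p\<close>
  leaves the determinant of their coefficients. One strict bound is enough, provided that it survives
  the multiplication by \<open>c\<close> or \<open>c'\<close>. Exchanging \<open>p\<close> and \<open>q\<close> together with the two bounds gives
  the sign of \<open>p\<close>.
\<close>
lemma pos_between_lines:
  fixes p q :: real
  assumes "p * c \<le> q * s" "q * s' \<le> p * c'" "0 \<le> c" "0 < c'"
    and "p * c < q * s \<or> q * s' < p * c' \<and> 0 < c"
  shows "0 < q * (s * c' - c * s')"
proof -
  have "q * s' * c \<le> p * c' * c" "p * c * c' \<le> q * s * c'"
    using assms by (auto intro!: mult_right_mono)
  moreover have "q * s' * c < p * c' * c \<or> p * c * c' < q * s * c'"
    using assms by auto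
  ultimately show ?thesis
    by (auto simp: algebra_simps)
qed

text \<open>
  The phases \<open>pi/4\<close> and \<open>pi/4 - m * T\<close> use the matching of \<open>x (-t)\<close> and \<open>x t\<close> at \<open>t = 0\<close> and the
  boundary condition at \<open>t = T\<close>. The resulting bounds degenerate to equalities at \<open>t = 0\<close> and possibly at
  \<open>t = T\<close> respectively, but never both at the same \<open>t\<close>.
\<close>
lemma strongly_inverse_positive_if:
  assumes "T > 0" "0 < m" "m \<le> pi / (4 * T)" "lam \<ge> 0"
  shows "strongly_inverse_positive {-T..T} (F_space lam T) (reflection_op T m)"
  unfolding strongly_inverse_positive_def
proof (intro ballI impI)
  fix x assume x: "x \<in> F_space lam T"
    and pos: "ae_positive {-T..T} (reflection_op T m x)"
  have mT: "0 < m * T" "m * T \<le> pi / 4"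
    using assms by (auto simp: field_simps)
  have bc: "x (-T) \<ge> x T"
    using x \<open>lam \<ge> 0\<close> by (simp add: F_space_def)
  have both: "0 < x t \<and> 0 < x (-t)" if t: "0 \<le> t" "t \<le> T" for t
  proof -
    define A B where "A = m * t + pi / 4" and "B = m * t + (pi / 4 - m * T)"
    have lt: "0 \<le> m * t" "m * t \<le> m * T" using t assms by auto
    then have A: "0 < sin A" "0 \<le> cos A" and B: "0 \<le> sin B" "0 < cos B"
      using mT pi_gt_zero unfolding A_def B_def
      by (auto intro!: sin_gt_zero cos_ge_zero sin_ge_zero cos_gt_zero_pi; linarith)+
    have qA: "x (-t) * cos A < x t * sin A" if "0 < t"
      using rotated_coordinate_less[OF \<open>T > 0\<close> x pos \<open>0 < m\<close>, of "pi / 4" 0 t] that t mT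
      by (simp add: A_def sin_45 cos_45)
    have qA': "x (-t) * cos A \<le> x t * sin A"
      using qA t by (cases "t = 0") (auto simp: A_def sin_45 cos_45)
    have sT: "0 \<le> x (-T) * cos (m * T + (pi / 4 - m * T)) - x T * sin (m * T + (pi / 4 - m * T))"
      using bc by (simp add: sin_45 cos_45 mult_right_mono)
    have pB: "x t * sin B < x (-t) * cos B" if "t < T"
      using rotated_coordinate_less[OF \<open>T > 0\<close> x pos \<open>0 < m\<close>, of "pi / 4 - m * T" t T] that t mT sT
      by (simp add: B_def)
    have pB': "x t * sin B \<le> x (-t) * cos B"
      using pB t sT by (cases "t = T") (auto simp: B_def)
    \<comment> \<open>The determinant is \<open>sin (m * T)\<close>, independent of \<open>t\<close>.\<close>
    have "sin (A - B) > 0"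
      using mT pi_gt_zero by (auto simp: A_def B_def intro!: sin_gt_zero)
    then have s: "sin A * cos B - cos A * sin B > 0"
      by (simp add: sin_diff)
    have "0 < x t * (sin A * cos B - cos A * sin B)"
    proof (rule pos_between_lines[OF qA' pB'])
      show "x (-t) * cos A < x t * sin A \<or> x t * sin B < x (-t) * cos B \<and> 0 < cos A"
        using qA pB t \<open>T > 0\<close> by (cases "t = 0") (auto simp: A_def cos_45)
    qed (use A B in auto)
    moreover have "0 < x (-t) * (cos B * sin A - sin B * cos A)"
    proof (rule pos_between_lines[OF pB' qA'])
      show "x t * sin B < x (-t) * cos B \<or> x (-t) * cos A < x t * sin A \<and> 0 < sin B"
        using qA pB t \<open>T > 0\<close> by (cases "t = T") (auto simp: B_def sin_45)
    qed (use A B in auto)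
    ultimately show ?thesis
      using s by (simp add: zero_less_mult_iff mult.commute)
  qed
  fix t assume "t \<in> {-T..T}"
  then show "0 < x t"
    using both[of t] both[of "-t"] by (cases "0 \<le> t") auto
qed

section \<open>Necessity\<close>
lemma in_F_spaceI:
  assumes "\<And>t. t \<in> {-T..T} \<Longrightarrow> (x has_real_derivative x' t) (at t within {-T..T})"
    and "x (-T) - x T = lam"
  shows "x \<in> F_space lam T"
  using assms unfolding F_space_def differentiable_on_def real_differentiable_def by blast

lemma ae_positive_if: "(\<And>t. t \<in> I \<Longrightarrow> 0 < y t) \<Longrightarrow> ae_positive I y"
  unfolding ae_positive_def by (rule AE_I2) (simp add: space_restrict_space)

text \<open>
  The lower bound \<open>\<delta>\<close> lets a large multiple of \<open>y\<close> absorb whatever the operator makes of the affine function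
  \<open>t \<mapsto> - lam / (2 * T) * (t - t0)\<close>. That function supplies the jump \<open>lam\<close>, and since it vanishes at
  \<open>t0\<close>, it leaves the sign of \<open>y t0\<close> alone.
\<close>
lemma not_strongly_inverse_positiveI:
  assumes "T > 0" "\<delta> > 0"
    and dy: "\<And>t. t \<in> {-T..T} \<Longrightarrow> (y has_real_derivative y' t) (at t within {-T..T})"
    and "y (-T) = y T"
    and ge: "\<And>t. t \<in> {-T..T} \<Longrightarrow> \<delta> \<le> y' t + m * y (-t)"
    and "t0 \<in> {-T..T}" "y t0 \<le> 0"
  shows "\<not> strongly_inverse_positive {-T..T} (F_space lam T) (reflection_op T m)"
proof
  assume sip: "strongly_inverse_positive {-T..T} (F_space lam T) (reflection_op T m)"
  define c where "c = - lam / (2 * T)"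
  \<comment> \<open>One more than a bound for the image of the affine function on the interval.\<close>
  define M where "M = \<bar>c\<bar> * (1 + \<bar>m\<bar> * (2 * T)) + 1"
  define K where "K = M / \<delta>"
  have "M > 0" using \<open>T > 0\<close> by (auto simp: M_def intro!: add_nonneg_pos)
  then have "K > 0" "K * \<delta> = M" using \<open>\<delta> > 0\<close> by (auto simp: K_def)
  define x where "x = (\<lambda>t. c * (t - t0) + K * y t)"
  have dx: "(x has_real_derivative c + K * y' t) (at t within {-T..T})" if "t \<in> {-T..T}" for t
    unfolding x_def by (rule derivative_eq_intros dy[OF that] refl)+ simp
  have "x \<in> F_space lam T"
    by (rule in_F_spaceI[OF dx]) (use \<open>T > 0\<close> \<open>y (-T) = y T\<close> in \<open>auto simp: x_def c_def field_simps\<close>)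
  moreover have "ae_positive {-T..T} (reflection_op T m x)"
  proof (rule ae_positive_if)
    fix t assume t: "t \<in> {-T..T}"
    have "\<bar>c * (1 + m * (-t - t0))\<bar> \<le> \<bar>c\<bar> * (1 + \<bar>m\<bar> * (2 * T))"
    proof -
      have "\<bar>m * (-t - t0)\<bar> \<le> \<bar>m\<bar> * (2 * T)"
        using t \<open>t0 \<in> _\<close> by (auto simp: abs_mult intro!: mult_left_mono)
      then have "\<bar>1 + m * (-t - t0)\<bar> \<le> 1 + \<bar>m\<bar> * (2 * T)" by linarith
      then show ?thesis by (auto simp: abs_mult intro!: mult_left_mono)
    qed
    moreover have "K * (y' t + m * y (-t)) \<ge> M"
      using mult_left_mono[OF ge[OF t], of K] \<open>K > 0\<close> \<open>K * \<delta> = M\<close> by simp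
    ultimately have "0 < c * (1 + m * (-t - t0)) + K * (y' t + m * y (-t))"
      unfolding M_def by linarith
    then show "0 < reflection_op T m x t"
      using reflection_op_eq[OF dx[OF t] t \<open>T > 0\<close>, of m] by (simp add: x_def algebra_simps)
  qed
  ultimately have "0 < x t0"
    using sip \<open>t0 \<in> _\<close> unfolding strongly_inverse_positive_def by blast
  then show False
    using \<open>K > 0\<close> \<open>y t0 \<le> 0\<close> by (simp add: x_def zero_less_mult_iff)
qed

lemma not_strongly_inverse_positive_neg:
  assumes "T > 0" "m < 0"
  shows "\<not> strongly_inverse_positive {-T..T} (F_space lam T) (reflection_op T m)"
  by (rule not_strongly_inverse_positiveI[where y = "\<lambda>_. -1" and y' = "\<lambda>_. 0" and \<delta> = "-m" and ?t0.0 = 0])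
     (use assms in auto)

text \<open>
  For \<open>y t = 1 + cos (w * t + pi/4)\<close>, the phase \<open>pi/4\<close> turns the reflected cosine into the sine, so the
  derivative and the reflected term combine into a single wave: the image of \<open>y\<close> is
  \<open>m + (m - w) * sin (w * t + pi/4)\<close>. With \<open>w = pi / T\<close>, which makes \<open>y\<close> periodic of period
  \<open>2 * T\<close>, it is bounded below by \<open>m - \<bar>m - w\<bar>\<close>, positive exactly for \<open>m > w / 2\<close>.
\<close>
lemma not_strongly_inverse_positive_large:
  assumes "T > 0" "m * T > pi / 2"
  shows "\<not> strongly_inverse_positive {-T..T} (F_space lam T) (reflection_op T m)"
proof -
  define w where "w = pi / T"
  have w: "w > 0" "w * T = pi" "w < 2 * m"
    using assms by (auto simp: w_def field_simps)
  show ?thesis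
  proof (rule not_strongly_inverse_positiveI[where y = "\<lambda>t. 1 + cos (w * t + pi / 4)"
        and y' = "\<lambda>t. - w * sin (w * t + pi / 4)" and \<delta> = "m - \<bar>m - w\<bar>" and ?t0.0 = "3 * T / 4"])
    show "0 < m - \<bar>m - w\<bar>" using w by linarith
    show "1 + cos (w * - T + pi / 4) = 1 + cos (w * T + pi / 4)"
    proof -
      have "w * - T = - pi" using w(2) by simp
      then show ?thesis by (simp only: w(2) cos_add) simp
    qed
    show "1 + cos (w * (3 * T / 4) + pi / 4) \<le> 0"
    proof -
      have "w * (3 * T / 4) + pi / 4 = pi" using w(2) by (simp add: field_simps)
      then show ?thesis by simp
    qed
    fix t
    have "\<bar>(m - w) * sin (w * t + pi / 4)\<bar> \<le> \<bar>m - w\<bar>"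
      by (simp add: abs_mult mult_left_le)
    then have "m - \<bar>m - w\<bar> \<le> m + (m - w) * sin (w * t + pi / 4)" by linarith
    also have "sin (w * t + pi / 4) = cos (w * - t + pi / 4)"
      by (simp add: sin_add cos_diff sin_45 cos_45 algebra_simps)
    then have "m + (m - w) * sin (w * t + pi / 4) =
        - w * sin (w * t + pi / 4) + m * (1 + cos (w * - t + pi / 4))"
      by (simp add: algebra_simps)
    finally show "m - \<bar>m - w\<bar> \<le> - w * sin (w * t + pi / 4) + m * (1 + cos (w * - t + pi / 4))" .
  qed (use assms in \<open>auto intro!: derivative_eq_intros\<close>)
qed

text \<open>
  The homogeneous solution \<open>cos (m * t) - sin (m * t)\<close> becomes negative beyond \<open>m * t = pi/4\<close>, which
  happens before \<open>T\<close>. Its boundary values differ by \<open>2 * sin (m * T)\<close>; adding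
  \<open>sin (m * T) * (t / T) ^ (2 * n + 3)\<close> makes them equal. The image of this odd power has the sign of
  \<open>2 * n + 3 - m * t\<close>, hence is nonnegative, and for large \<open>n\<close> the power hardly changes the value at
  a point \<open>t0 < T\<close>. There is then room for a positive constant, whose image is a positive constant.
\<close>
lemma not_strongly_inverse_positive_medium:
  assumes "T > 0" "pi / 4 < m * T" "m * T \<le> pi / 2"
  shows "\<not> strongly_inverse_positive {-T..T} (F_space lam T) (reflection_op T m)"
proof -
  have m: "m > 0" using assms pi_gt_zero zero_less_mult_pos2[of m T] by linarith
  \<comment> \<open>Any point strictly between the zero of the homogeneous solution and \<open>T\<close> would do.\<close>
  define t0 where "t0 = (T + pi / (4 * m)) / 2"
  have lt: "pi / (4 * m) < T" "0 < pi / (4 * m)" using assms m by (auto simp: field_simps)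
  then have t0: "0 < t0" "t0 < T" "pi / (4 * m) < t0" by (auto simp: t0_def)
  have "pi / 4 < m * t0" using t0(3) m by (simp add: field_simps)
  moreover have "m * t0 < pi / 2"
    using t0(2) m assms(3) mult_strict_left_mono[of t0 T m] by linarith
  ultimately have "sin (pi / 2 - m * t0) < sin (m * t0)"
    by (intro sin_monotone_2pi) auto
  then have neg: "0 < sin (m * t0) - cos (m * t0)" by (simp add: sin_cos_eq)
  have s: "0 < sin (m * T)" using assms pi_gt_zero by (intro sin_gt_zero) linarith+
  obtain n where n: "(t0 / T) ^ n < sin (m * t0) - cos (m * t0)"
    using real_arch_pow_inv[OF neg, of "t0 / T"] t0 by auto
  have "sin (m * T) * (t0 / T) ^ (2 * n + 3) \<le> 1 * (t0 / T) ^ n"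
    using t0 by (intro mult_mono power_decreasing) auto
  then have less: "sin (m * T) * (t0 / T) ^ (2 * n + 3) < sin (m * t0) - cos (m * t0)"
    using n by linarith
  \<comment> \<open>The constant that lifts the value at \<open>t0\<close> to exactly zero.\<close>
  define \<epsilon> where "\<epsilon> = sin (m * t0) - cos (m * t0) - sin (m * T) * (t0 / T) ^ (2 * n + 3)"
  have "\<epsilon> > 0" using less by (simp add: \<epsilon>_def)
  define k where "k = 2 * n + 2"
  have k: "Suc k = 2 * n + 3" "even k" by (auto simp: k_def)
  show ?thesis
  proof (rule not_strongly_inverse_positiveI[where ?t0.0 = t0 and \<delta> = "m * \<epsilon>"
      and y = "\<lambda>t. cos (m * t) - sin (m * t) + sin (m * T) * (t / T) ^ Suc k + \<epsilon>"
      and y' = "\<lambda>t. - m * sin (m * t) - m * cos (m * t)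
                  + sin (m * T) * (real (Suc k) * (t / T) ^ k / T)"])
    fix t assume t: "t \<in> {-T..T}"
    show "((\<lambda>t. cos (m * t) - sin (m * t) + sin (m * T) * (t / T) ^ Suc k + \<epsilon>) has_real_derivative
        - m * sin (m * t) - m * cos (m * t)
          + sin (m * T) * (real (Suc k) * (t / T) ^ k / T)) (at t within {-T..T})"
    proof -
      have dpow: "((\<lambda>t. (t / T) ^ Suc k) has_real_derivative real (Suc k) * (t / T) ^ k / T) (at t within {-T..T})"
        using DERIV_power[OF DERIV_cdivide[OF DERIV_ident], where n = "Suc k"]
        by simp
      show ?thesis
        by (rule dpow derivative_eq_intros refl | simp)+
    qed
    have "m * t \<le> m * T" using t m by auto
    then have "m * t \<le> real (Suc k)"
      using assms(3) pi_less_4 by (simp add: k_def)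
    then have "0 \<le> sin (m * T) * ((t / T) ^ k * ((real (Suc k) - m * t) / T))"
      using s k \<open>T > 0\<close> by (intro mult_nonneg_nonneg zero_le_even_power) auto
    also have "\<dots> = sin (m * T) * (real (Suc k) * (t / T) ^ k / T) + m * (sin (m * T) * (- t / T) ^ Suc k)"
      using \<open>even k\<close> \<open>T > 0\<close> by (simp add: field_simps)
    finally show "m * \<epsilon> \<le> - m * sin (m * t) - m * cos (m * t)
          + sin (m * T) * (real (Suc k) * (t / T) ^ k / T)
        + m * (cos (m * - t) - sin (m * - t) + sin (m * T) * (- t / T) ^ Suc k + \<epsilon>)"
      by (simp add: algebra_simps)
  next
    show "cos (m * - T) - sin (m * - T) + sin (m * T) * (- T / T) ^ Suc k + \<epsilon> =
      cos (m * T) - sin (m * T) + sin (m * T) * (T / T) ^ Suc k + \<epsilon>"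
      using \<open>even k\<close> \<open>T > 0\<close> by simp
    show "cos (m * t0) - sin (m * t0) + sin (m * T) * (t0 / T) ^ Suc k + \<epsilon> \<le> 0"
      unfolding \<epsilon>_def k by simp
  qed (use assms m \<open>\<epsilon> > 0\<close> t0 in auto)
qed

text \<open>
  The multiple \<open>A\<close> of the homogeneous solution with jump \<open>lam\<close> is negative because \<open>sin (m * T) > 0\<close>,
  and its value at \<open>0\<close> is \<open>A\<close>. The constant \<open>- A > 0\<close> has a positive image and raises that value only to
  \<open>0\<close>.
\<close>
lemma not_strongly_inverse_positive_lam_neg:
  assumes "T > 0" "0 < m" "m * T < pi" "lam < 0"
  shows "\<not> strongly_inverse_positive {-T..T} (F_space lam T) (reflection_op T m)"
proof
  assume sip: "strongly_inverse_positive {-T..T} (F_space lam T) (reflection_op T m)"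
  have s: "0 < sin (m * T)" using assms by (intro sin_gt_zero) auto
  define A where "A = lam / (2 * sin (m * T))"
  have "A < 0" using s \<open>lam < 0\<close> by (simp add: A_def divide_neg_pos)
  define x where "x = (\<lambda>t. A * (cos (m * t) - sin (m * t)) - A)"
  have dx: "(x has_real_derivative A * (- m * sin (m * t) - m * cos (m * t))) (at t within {-T..T})" for t
    unfolding x_def by (rule derivative_eq_intros refl)+ simp
  have "x \<in> F_space lam T"
    by (rule in_F_spaceI[OF dx]) (use s in \<open>auto simp: x_def A_def field_simps\<close>)
  moreover have "ae_positive {-T..T} (reflection_op T m x)"
  proof (rule ae_positive_if)
    fix t assume t: "t \<in> {-T..T}"
    have "reflection_op T m x t = - A * m"
      using reflection_op_eq[OF dx t \<open>T > 0\<close>, of m] by (simp add: x_def algebra_simps)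
    then show "0 < reflection_op T m x t"
      using \<open>A < 0\<close> \<open>0 < m\<close> by (simp add: mult_neg_pos)
  qed
  ultimately have "0 < x 0"
    using sip \<open>T > 0\<close> unfolding strongly_inverse_positive_def by auto
  then show False by (simp add: x_def)
qed

lemma strongly_inverse_positive_iff:
  assumes "T > 0" "m \<noteq> 0"
  shows "strongly_inverse_positive {-T..T} (F_space lam T) (reflection_op T m) \<longleftrightarrow>
    m \<in> {0<..pi / (4 * T)} \<and> lam \<ge> 0" (is "?sip \<longleftrightarrow> _")
proof
  assume ?sip
  then have "\<not> m < 0" "\<not> m * T > pi / 2" "\<not> (pi / 4 < m * T \<and> m * T \<le> pi / 2)"
    using not_strongly_inverse_positive_neg not_strongly_inverse_positive_large
      not_strongly_inverse_positive_medium \<open>T > 0\<close> by blast+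
  then have m: "m > 0" "m * T \<le> pi / 4"
    using \<open>m \<noteq> 0\<close> by linarith+
  then have "m * T < pi" using pi_gt_zero by linarith
  then have "lam \<ge> 0"
    using not_strongly_inverse_positive_lam_neg \<open>?sip\<close> \<open>T > 0\<close> m by (meson not_le)
  with m show "m \<in> {0<..pi / (4 * T)} \<and> lam \<ge> 0"
    using \<open>T > 0\<close> by (auto simp: field_simps)
next
  assume "m \<in> {0<..pi / (4 * T)} \<and> lam \<ge> 0"
  then show ?sip
    using strongly_inverse_positive_if \<open>T > 0\<close> by auto
qed

section \<open>Point reflection and the negative case\<close>
lemma point_reflection_F_space:
  assumes "T > 0" and x: "x \<in> F_space lam T"
    and pos: "ae_positive {-T..T} (reflection_op T m x)"
  shows "(\<lambda>t. - x (-t)) \<in> F_space lam T"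
    and "ae_positive {-T..T} (reflection_op T (-m) (\<lambda>t. - x (-t)))"
proof -
  define h where "h = reflection_op T m x"
  have d: "((\<lambda>t. - x (-t)) has_real_derivative h (-t) - m * x t) (at t within {-T..T})"
    if t: "t \<in> {-T..T}" for t
  proof -
    have mt: "-t \<in> {-T..T}" using t by auto
    obtain D where D: "(x has_real_derivative D) (at (-t) within {-T..T})"
      using F_space_has_derivative[OF x mt] .
    have "h (-t) = D + m * x t"
      using reflection_op_eq[OF D mt \<open>T > 0\<close>, of m] by (simp add: h_def)
    then have "(x has_real_derivative h (-t) - m * x t) (at (-t) within uminus ` {-T..T})"
      using D by simp
    from DERIV_minus[OF has_real_derivative_compose_uminus[OF this]] show ?thesis by simp
  qed
  show "(\<lambda>t. - x (-t)) \<in> F_space lam T"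
    by (rule in_F_spaceI[OF d]) (use x in \<open>auto simp: F_space_def\<close>)
  obtain N where N: "negligible N" "\<And>t. t \<in> {-T..T} - N \<Longrightarrow> 0 < h t"
    using pos by (auto simp: ae_positive_iff_negligible h_def)
  have "0 < reflection_op T (-m) (\<lambda>t. - x (-t)) t" if t: "t \<in> {-T..T} - uminus ` N" for t
  proof -
    have "-t \<in> {-T..T} - N" using t by force
    then show ?thesis
      using N(2)[of "-t"] reflection_op_eq[OF d _ \<open>T > 0\<close>, of t "-m"] t by auto
  qed
  then show "ae_positive {-T..T} (reflection_op T (-m) (\<lambda>t. - x (-t)))"
    unfolding ae_positive_iff_negligible using negligible_uminus[OF N(1)] by blast
qed

lemma strongly_inverse_negative_iff_positive_uminus:
  assumes "T > 0"
  shows "strongly_inverse_negative {-T..T} (F_space lam T) (reflection_op T m) \<longleftrightarrow>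
    strongly_inverse_positive {-T..T} (F_space lam T) (reflection_op T (-m))"
proof
  assume neg: "strongly_inverse_negative {-T..T} (F_space lam T) (reflection_op T m)"
  show "strongly_inverse_positive {-T..T} (F_space lam T) (reflection_op T (-m))"
    unfolding strongly_inverse_positive_def
  proof (intro ballI impI)
    fix x t assume *: "x \<in> F_space lam T" "ae_positive {-T..T} (reflection_op T (-m) x)"
      and "t \<in> {-T..T}"
    then have "- t \<in> {-T..T}" by auto
    then have "- x (- (- t)) < 0"
      using point_reflection_F_space[OF assms *] neg
      unfolding strongly_inverse_negative_def by fastforce
    then show "0 < x t" by simp
  qed
next
  assume sip: "strongly_inverse_positive {-T..T} (F_space lam T) (reflection_op T (-m))"
  show "strongly_inverse_negative {-T..T} (F_space lam T) (reflection_op T m)"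
    unfolding strongly_inverse_negative_def
  proof (intro ballI impI)
    fix x t assume *: "x \<in> F_space lam T" "ae_positive {-T..T} (reflection_op T m x)"
      and "t \<in> {-T..T}"
    then have "- t \<in> {-T..T}" by auto
    then have "0 < - x (- (- t))"
      using point_reflection_F_space[OF assms *] sip
      unfolding strongly_inverse_positive_def by fastforce
    then show "x t < 0" by simp
  qed
qed

theorem corollary4p5:
  fixes T m lam :: real
  assumes "T > 0" and "m \<noteq> 0"
  shows "(strongly_inverse_positive {-T..T} (F_space lam T) (reflection_op T m) \<longleftrightarrow>
            m \<in> {0<..pi / (4 * T)} \<and> lam \<ge> 0) \<and>
         (strongly_inverse_negative {-T..T} (F_space lam T) (reflection_op T m) \<longleftrightarrow>
            m \<in> {-(pi / (4 * T))..<0} \<and> lam \<ge> 0)"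
  using strongly_inverse_positive_iff[OF assms] strongly_inverse_positive_iff[of T "-m" lam] assms
  by (auto simp: strongly_inverse_negative_iff_positive_uminus)

end
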